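(* Let $a,c,p\in\overline{\Lambda}^{(1)}$ with $c$ and $p$ invertible, $p=p^\dag$, $|a_B|<1$, and $p-a^\dag pa=c^\dag c$. Let $$b_a(z)=1-(1-z)c\star(1-za)^{-\star}p^{-1}(1-a)^{-\dag}c^\dag .$$ Then $b_a$ vanishes at $\omega=c^{-\dag}a^\dag c^\dag$, that is, $b_a(\omega)=0$. Moreover, $b_a$ can be factorized as $$b_a(z)=(z-\omega)\star\left[1+(\omega-1)c^{-\dag}pc^{-1}\omega^\dag\right]\star(1-z\omega^\dag)^{-\star}\,c\,p^{-1}(1-a)^{-\dag}c^\dag .$$
   Context: $\Lambda$ is the unital complex algebra generated by $1$ and countably many elements $i_1,i_2,\ldots$, linearly independent over $\mathbb{C}$, with $i_ni_m+i_mi_n=0$ (so $i_n^2=0$). With $i_\alpha=i_{a_1}\cdots i_{a_t}$ and $|\alpha|=t$ for finite strictly increasing tuples $\alpha=(a_1<\cdots<a_t)$ of positive integers, and $i_0=1$, $\overline{\Lambda}^{(1)}$ is the Banach algebra of all sums $z=z_0+\sum_\alpha z_\alpha i_\alpha$, $z_\alpha\in\mathbb{C}$, with $\|z\|_1=|z_0|+\sum_\alpha|z_\alpha|<\infty$. The body is $z_B=z_0$, and $z^\dag=\overline{z_0}+\sum_\alpha(-1)^{|\alpha|(|\alpha|-1)/2}\overline{z_\alpha}i_\alpha$, so $(zw)^\dag=w^\dag z^\dag$; $x^{-\dag}=(x^{-1})^\dag=(x^\dag)^{-1}$. For power series $f(z)=\sum_{n\ge0} z^nf_n$, $g(z)=\sum_{n\ge0}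 z^ng_n$ with coefficients in $\overline{\Lambda}^{(1)}$ written on the right of the powers of $z\in\overline{\Lambda}^{(1)}$, the star product is $(f\star g)(z)=\sum_nz^n\sum_{u=0}^{n}f_ug_{n-u}$, and $f^{-\star}$ is the $\star$-inverse; e.g. $(1-za)^{-\star}=\sum_nz^na^n$. Constants multiply series as constant series for $\star$, and all products in the two displayed formulas are to be read as star products of power series in $z$. $f(\omega)$ means $\sum_n\omega^nf_n$. The function $b_a$ is called a Blaschke factor. *)

theory Defs
  imports "HOL-Analysis.Infinite_Sum" "HOL-Computational_Algebra.Formal_Power_Series"
begin

section \<open>The Banach algebra of absolutely summable Grassmann numbers\<close>

text \<open>
  A strictly increasing tuple of positive integers is encoded by the finite set of its entries;
  the empty set is the index of the unit \<open>i\<^sub>0 = 1\<close>, so the body of a Grassmann number is its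
  coefficient at \<open>{}\<close>.
\<close>

definition multi_indices :: "nat set set" where
  "multi_indices = {A. finite A \<and> A \<subseteq> {1..}}"

typedef grassmann =
  "{f :: nat set \<Rightarrow> complex. (\<forall>A. A \<notin> multi_indices \<longrightarrow> f A = 0) \<and> f abs_summable_on UNIV}"
  morphisms coeff Abs_grassmann
  by (rule exI[of _ "\<lambda>_. 0"]) simp

setup_lifting type_definition_grassmann

lemma grassmann_eqI: "(\<And>A. coeff x A = coeff y A) \<Longrightarrow> x = y"
  by (simp add: coeff_inject[symmetric] fun_eq_iff)

lemma abs_summable_coeff: "coeff x abs_summable_on UNIV"
  using coeff[of x] by simp

lemma coeff_eq_0: "A \<notin> multi_indices \<Longrightarrow> coeff x A = 0"
  using coeff[of x] by simp

text \<open>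
  For disjoint \<open>A\<close>, \<open>B\<close>, sorting the concatenation of the corresponding tuples takes
  \<open>inversions A B\<close> transpositions of neighbours, so that
  \<open>i\<^sub>A i\<^sub>B = (-1) ^ inversions A B \<cdot> i\<^bsub>A \<union> B\<^esub>\<close>, whereas \<open>i\<^sub>A i\<^sub>B = 0\<close> if \<open>A\<close>, \<open>B\<close> have a common
  element. Hence only the pairs \<open>(A, C - A)\<close> with \<open>A \<subseteq> C\<close> contribute to the
  coefficient of a product at \<open>C\<close>.
\<close>

definition inversions :: "nat set \<Rightarrow> nat set \<Rightarrow> nat" where
  "inversions A B = card {(a, b). a \<in> A \<and> b \<in> B \<and> b < a}"

definition grass_mult :: "(nat set \<Rightarrow> complex) \<Rightarrow> (nat set \<Rightarrow> complex) \<Rightarrow> nat set \<Rightarrow> complex" where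
  "grass_mult f g C = (\<Sum>A\<in>Pow C. (-1) ^ inversions A (C - A) * (f A * g (C - A)))"

lemma inversions_empty [simp]: "inversions {} A = 0" "inversions A {} = 0"
  by (simp_all add: inversions_def)

lemma inversions_Un1:
  assumes "finite A" "finite B" "finite C" "A \<inter> B = {}"
  shows "inversions (A \<union> B) C = inversions A C + inversions B C"
proof -
  have "{(a, b). a \<in> A \<union> B \<and> b \<in> C \<and> b < a} =
        {(a, b). a \<in> A \<and> b \<in> C \<and> b < a} \<union> {(a, b). a \<in> B \<and> b \<in> C \<and> b < a}"
    by auto
  moreover have "finite {(a, b). a \<in> A \<and> b \<in> C \<and> b < a}"
    by (rule finite_subset[of _ "A \<times> C"]) (use assms in auto)
  moreover have "finite {(a, b). a \<in> B \<and> b \<in> C \<and> b < a}"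
    by (rule finite_subset[of _ "B \<times> C"]) (use assms in auto)
  ultimately show ?thesis
    unfolding inversions_def using assms(4) by (subst card_Un_disjoint[symmetric]) auto
qed

lemma inversions_Un2:
  assumes "finite A" "finite B" "finite C" "B \<inter> C = {}"
  shows "inversions A (B \<union> C) = inversions A B + inversions A C"
proof -
  have "{(a, b). a \<in> A \<and> b \<in> B \<union> C \<and> b < a} =
        {(a, b). a \<in> A \<and> b \<in> B \<and> b < a} \<union> {(a, b). a \<in> A \<and> b \<in> C \<and> b < a}"
    by auto
  moreover have "finite {(a, b). a \<in> A \<and> b \<in> B \<and> b < a}"
    by (rule finite_subset[of _ "A \<times> B"]) (use assms in auto)
  moreover have "finite {(a, b). a \<in> A \<and> b \<in> C \<and> b < a}"
    by (rule finite_subset[of _ "A \<times> C"]) (use assms in auto)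
  ultimately show ?thesis
    unfolding inversions_def using assms(4) by (subst card_Un_disjoint[symmetric]) auto
qed

lemma inversions_commute:
  assumes "finite A" "finite B" "A \<inter> B = {}"
  shows "inversions A B + inversions B A = card A * card B"
proof -
  define S where "S = {(a, b). a \<in> A \<and> b \<in> B \<and> b < a}"
  define T where "T = {(a, b). a \<in> A \<and> b \<in> B \<and> a < b}"
  have sub: "S \<subseteq> A \<times> B" "T \<subseteq> A \<times> B" "S \<inter> T = {}"
    by (auto simp: S_def T_def)
  have "A \<times> B \<subseteq> S \<union> T"
  proof clarify
    fix a b assume ab: "a \<in> A" "b \<in> B" "(a, b) \<notin> T"
    have "a \<noteq> b"
      using ab assms(3) by blast
    then show "(a, b) \<in> S"
      using ab by (simp add: S_def T_def)
  qed
  with sub have "S \<union> T = A \<times> B"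
    by blast
  moreover have "finite S" "finite T"
    using sub assms(1,2) by (meson finite_SigmaI finite_subset)+
  ultimately have "card S + card T = card A * card B"
    using sub(3) card_Un_disjoint[of S T] by (simp add: card_cartesian_product)
  moreover have "inversions B A = card T"
    unfolding inversions_def
    by (rule bij_betw_same_card[of prod.swap], rule bij_betw_byWitness[of _ prod.swap])
      (auto simp: T_def)
  ultimately show ?thesis
    by (simp add: inversions_def S_def)
qed

lemma abs_summable_plus:
  fixes f g :: "nat set \<Rightarrow> complex"
  assumes "f abs_summable_on UNIV" "g abs_summable_on UNIV"
  shows "(\<lambda>A. f A + g A) abs_summable_on UNIV"
  by (rule abs_summable_on_comparison_test'[OF summable_on_add[OF assms]])
    (simp add: norm_triangle_ineq)

lemma infinite_grass_mult: "infinite C \<Longrightarrow> grass_mult f g C = 0"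
  by (simp add: grass_mult_def)

lemma sum_norm_grass_mult_le:
  assumes f: "f abs_summable_on UNIV" and g: "g abs_summable_on UNIV" and F: "finite F"
  shows "(\<Sum>C\<in>F. norm (grass_mult f g C)) \<le>
           (\<Sum>\<^sub>\<infinity>A. norm (f A)) * (\<Sum>\<^sub>\<infinity>A. norm (g A))"
proof -
  define F' where "F' = {C\<in>F. finite C}"
  define G where "G = (\<Union>C\<in>F'. Pow C)"
  let ?h = "\<lambda>C A. norm (f A) * norm (g (C - A))"
  have fin: "finite F'" "finite G"
    using F by (auto simp: F'_def G_def)
  have "(\<Sum>C\<in>F. norm (grass_mult f g C)) = (\<Sum>C\<in>F'. norm (grass_mult f g C))"
    by (rule sum.mono_neutral_right) (use F in \<open>auto simp: F'_def infinite_grass_mult\<close>)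
  also have "\<dots> \<le> (\<Sum>C\<in>F'. \<Sum>A\<in>Pow C. ?h C A)"
    unfolding grass_mult_def
    by (intro sum_mono sum_norm_le) (simp add: norm_mult norm_power)
  also have "\<dots> = (\<Sum>(C, A)\<in>Sigma F' Pow. ?h C A)"
    by (rule sum.Sigma) (use fin in \<open>auto simp: F'_def\<close>)
  also have "\<dots> = (\<Sum>(A, B)\<in>(\<lambda>(C, A). (A, C - A)) ` Sigma F' Pow. norm (f A) * norm (g B))"
  proof (subst sum.reindex)
    show "inj_on (\<lambda>(C, A). (A, C - A)) (Sigma F' Pow)"
      by (auto simp: inj_on_def)
  qed (auto intro!: sum.cong)
  also have "\<dots> \<le> (\<Sum>(A, B)\<in>G \<times> G. norm (f A) * norm (g B))"
    by (rule sum_mono2) (use fin in \<open>auto simp: G_def\<close>)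
  also have "\<dots> = (\<Sum>A\<in>G. norm (f A)) * (\<Sum>B\<in>G. norm (g B))"
    by (simp add: sum_product sum.cartesian_product)
  also have "\<dots> \<le> (\<Sum>\<^sub>\<infinity>A. norm (f A)) * (\<Sum>\<^sub>\<infinity>A. norm (g A))"
    using fin f g by (intro mult_mono finite_sum_le_infsum sum_nonneg infsum_nonneg) auto
  finally show ?thesis .
qed

lemma abs_summable_grass_mult:
  assumes "f abs_summable_on UNIV" "g abs_summable_on UNIV"
  shows "grass_mult f g abs_summable_on UNIV"
  using sum_norm_grass_mult_le[OF assms]
  by (intro nonneg_bdd_above_summable_on) (auto simp: bdd_above_def)

lemma grass_mult_outside:
  assumes "\<And>A. A \<notin> multi_indices \<Longrightarrow> f A = 0" "\<And>A. A \<notin> multi_indices \<Longrightarrow> g A = 0"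
    and "C \<notin> multi_indices"
  shows "grass_mult f g C = 0"
proof (cases "finite C")
  case True
  have "f A * g (C - A) = 0" if "A \<subseteq> C" for A
  proof -
    have "A \<notin> multi_indices \<or> C - A \<notin> multi_indices"
      using that assms(3) True by (auto simp: multi_indices_def)
    then show ?thesis
      using assms(1,2) by auto
  qed
  then show ?thesis
    by (auto simp: grass_mult_def intro!: sum.neutral)
qed (simp add: infinite_grass_mult)

lemma grass_mult_assoc: "grass_mult (grass_mult f g) h D = grass_mult f (grass_mult g h) D"
proof (cases "finite D")
  case True
  let ?s = "\<lambda>A B. (-1) ^ inversions A B :: complex"
  let ?t = "\<lambda>A B C. ?s A B * ?s A C * ?s B C * (f A * g B * h C)"
  have "grass_mult (grass_mult f g) h D = (\<Sum>E\<in>Pow D. \<Sum>A\<in>Pow E. ?t A (E - A) (D - E))"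
    unfolding grass_mult_def sum_distrib_left sum_distrib_right
  proof (intro sum.cong refl)
    fix E A assume "E \<in> Pow D" "A \<in> Pow E"
    then have "finite A" "finite (E - A)" "finite (D - E)" "A \<union> (E - A) = E"
      using True by (auto intro: finite_subset)
    then have "inversions E (D - E) = inversions A (D - E) + inversions (E - A) (D - E)"
      using inversions_Un1[of A "E - A" "D - E"] by auto
    then show "?s E (D - E) * (?s A (E - A) * (f A * g (E - A)) * h (D - E)) =
        ?t A (E - A) (D - E)"
      by (simp add: power_add mult_ac)
  qed
  also have "\<dots> = (\<Sum>(E, A)\<in>Sigma (Pow D) Pow. ?t A (E - A) (D - E))"
    by (rule sum.Sigma) (use True in \<open>auto intro: finite_subset\<close>)
  also have "\<dots> = (\<Sum>(A, B)\<in>(SIGMA A:Pow D. Pow (D - A)). ?t A B (D - A - B))"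
    by (rule sum.reindex_bij_witness[of _ "\<lambda>(A, B). (A \<union> B, A)" "\<lambda>(E, A). (A, E - A)"])
      (auto simp: Un_Diff Diff_eq Int_ac intro!: arg_cong2[where f = "(*)"] arg_cong2[where f = inversions]
         arg_cong[where f = h] arg_cong[where f = g] arg_cong2[where f = power])
  also have "\<dots> = (\<Sum>A\<in>Pow D. \<Sum>B\<in>Pow (D - A). ?t A B (D - A - B))"
    by (rule sum.Sigma[symmetric]) (use True in \<open>auto intro: finite_subset\<close>)
  also have "\<dots> = grass_mult f (grass_mult g h) D"
    unfolding grass_mult_def sum_distrib_left sum_distrib_right
  proof (intro sum.cong refl)
    fix A B assume "A \<in> Pow D" "B \<in> Pow (D - A)"
    then have "finite A" "finite B" "finite (D - A - B)" "B \<union> (D - A - B) = D - A"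
      using True by (auto intro: finite_subset)
    then have "inversions A (D - A) = inversions A B + inversions A (D - A - B)"
      using inversions_Un2[of A B "D - A - B"] by auto
    then show "?t A B (D - A - B) =
        ?s A (D - A) * (f A * (?s B (D - A - B) * (g B * h (D - A - B))))"
      by (simp add: power_add mult_ac)
  qed
  finally show ?thesis .
qed (simp add: infinite_grass_mult)

instantiation grassmann :: ring_1
begin

lift_definition zero_grassmann :: grassmann is "\<lambda>_. 0"
  by simp

lift_definition one_grassmann :: grassmann is "\<lambda>A. if A = {} then 1 else 0"
proof
  have "(\<lambda>A. norm (if A = {} then 1 else 0 :: complex)) summable_on {{} :: nat set}"
    by simp
  also have "?this \<longleftrightarrow> (\<lambda>A. if A = {} then 1 else 0 :: complex) abs_summable_on (UNIV :: nat set set)"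
    by (rule summable_on_cong_neutral) auto
  finally show "(\<lambda>A. if A = {} then 1 else 0 :: complex) abs_summable_on (UNIV :: nat set set)" .
qed (auto simp: multi_indices_def)

lift_definition plus_grassmann :: "grassmann \<Rightarrow> grassmann \<Rightarrow> grassmann" is "\<lambda>f g A. f A + g A"
  by (auto intro: abs_summable_plus)

lift_definition uminus_grassmann :: "grassmann \<Rightarrow> grassmann" is "\<lambda>f A. - f A"
  by simp

lift_definition minus_grassmann :: "grassmann \<Rightarrow> grassmann \<Rightarrow> grassmann" is "\<lambda>f g A. f A - g A"
proof -
  fix f g :: "nat set \<Rightarrow> complex"
  assume "(\<forall>A. A \<notin> multi_indices \<longrightarrow> f A = 0) \<and> f abs_summable_on UNIV"
    and "(\<forall>A. A \<notin> multi_indices \<longrightarrow> g A = 0) \<and> g abs_summable_on UNIV"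
  then show "(\<forall>A. A \<notin> multi_indices \<longrightarrow> f A - g A = 0) \<and> (\<lambda>A. f A - g A) abs_summable_on UNIV"
    using abs_summable_plus[of f "\<lambda>A. - g A"] by simp
qed

lift_definition times_grassmann :: "grassmann \<Rightarrow> grassmann \<Rightarrow> grassmann" is grass_mult
  by (auto intro: abs_summable_grass_mult grass_mult_outside)

instance
proof
  fix x y z :: grassmann
  show "x * y * z = x * (y * z)"
    by transfer (simp add: grass_mult_assoc fun_eq_iff)
  show "(x + y) * z = x * z + y * z" "x * (y + z) = x * y + x * z"
    by (transfer; simp add: grass_mult_def fun_eq_iff algebra_simps sum.distrib)+
  show "1 * x = x"
  proof (rule grassmann_eqI)
    fix C
    show "coeff (1 * x) C = coeff x C"
    proof (cases "finite C")
      case True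
      then show ?thesis
        by (simp add: times_grassmann.rep_eq one_grassmann.rep_eq grass_mult_def if_distrib
            if_distribR sum.delta cong: if_cong)
    qed (auto simp: times_grassmann.rep_eq infinite_grass_mult coeff_eq_0 multi_indices_def)
  qed
  show "x * 1 = x"
  proof (rule grassmann_eqI)
    fix C
    show "coeff (x * 1) C = coeff x C"
    proof (cases "finite C")
      case True
      have "coeff (x * 1) C =
          (\<Sum>A\<in>Pow C. if A = C then coeff x C else 0)"
        unfolding times_grassmann.rep_eq one_grassmann.rep_eq grass_mult_def
        by (rule sum.cong) auto
      then show ?thesis
        using True by simp
    qed (auto simp: times_grassmann.rep_eq infinite_grass_mult coeff_eq_0 multi_indices_def)
  qed
  show "(0 :: grassmann) \<noteq> 1"
    by transfer (auto simp: fun_eq_iff)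
qed (transfer; simp add: algebra_simps fun_eq_iff)+

end

instantiation grassmann :: real_normed_algebra_1
begin

lift_definition scaleR_grassmann :: "real \<Rightarrow> grassmann \<Rightarrow> grassmann" is "\<lambda>r f A. r *\<^sub>R f A"
  by (auto simp: norm_scaleR intro: summable_on_cmult_right)

definition norm_grassmann :: "grassmann \<Rightarrow> real" where
  "norm_grassmann z = (\<Sum>\<^sub>\<infinity>A. norm (coeff z A))"

definition dist_grassmann :: "grassmann \<Rightarrow> grassmann \<Rightarrow> real" where
  "dist_grassmann z w = norm (z - w)"

definition sgn_grassmann :: "grassmann \<Rightarrow> grassmann" where
  "sgn_grassmann z = inverse (norm z) *\<^sub>R z"

definition uniformity_grassmann :: "(grassmann \<times> grassmann) filter" where
  "uniformity_grassmann = (INF e\<in>{0<..}. principal {(z, w). dist z w < e})"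

definition open_grassmann :: "grassmann set \<Rightarrow> bool" where
  "open_grassmann U \<longleftrightarrow> (\<forall>z\<in>U. eventually (\<lambda>(z', w). z' = z \<longrightarrow> w \<in> U) uniformity)"

instance
proof
  fix x y :: grassmann and r s :: real
  show "r *\<^sub>R (x + y) = r *\<^sub>R x + r *\<^sub>R y" "(r + s) *\<^sub>R x = r *\<^sub>R x + s *\<^sub>R x"
    "r *\<^sub>R s *\<^sub>R x = (r * s) *\<^sub>R x" "1 *\<^sub>R x = x"
    by (transfer; simp add: algebra_simps fun_eq_iff)+
  show "r *\<^sub>R x * y = r *\<^sub>R (x * y)" "x * r *\<^sub>R y = r *\<^sub>R (x * y)"
    by (transfer; simp add: grass_mult_def scaleR_sum_right fun_eq_iff)+
  show "norm x = 0 \<longleftrightarrow> x = 0"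
  proof
    assume "norm x = 0"
    then have "norm (coeff x A) = 0" for A
      using abs_summable_coeff[of x] by (intro nonneg_infsum_le_0D[of "\<lambda>A. norm (coeff x A)" UNIV])
        (auto simp: norm_grassmann_def)
    then show "x = 0"
      by (intro grassmann_eqI) (simp add: zero_grassmann.rep_eq)
  qed (simp add: norm_grassmann_def zero_grassmann.rep_eq)
  show "norm (x + y) \<le> norm x + norm y"
    unfolding norm_grassmann_def plus_grassmann.rep_eq
    using abs_summable_coeff abs_summable_plus[OF abs_summable_coeff abs_summable_coeff]
    by (subst infsum_add[symmetric])
      (auto intro!: infsum_mono norm_triangle_ineq summable_on_add)
  show "norm (r *\<^sub>R x) = \<bar>r\<bar> * norm x"
    by (simp add: norm_grassmann_def scaleR_grassmann.rep_eq infsum_cmult_right'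
        del: norm_scaleR add: norm_scaleR)
  show "norm (x * y) \<le> norm x * norm y"
    unfolding norm_grassmann_def times_grassmann.rep_eq
    by (intro infsum_le_finite_sums abs_summable_grass_mult sum_norm_grass_mult_le
        abs_summable_coeff)
  show "norm (1 :: grassmann) = 1"
  proof -
    have "norm (1 :: grassmann) = (\<Sum>\<^sub>\<infinity>A\<in>{{}}. norm (coeff 1 A))"
      unfolding norm_grassmann_def
      by (rule infsum_cong_neutral) (auto simp: one_grassmann.rep_eq)
    then show ?thesis
      by (simp add: one_grassmann.rep_eq)
  qed
qed (simp_all add: dist_grassmann_def sgn_grassmann_def uniformity_grassmann_def open_grassmann_def)

end

lemma norm_coeff_le: "norm (coeff z A) \<le> norm z"
  using finite_sum_le_infsum[OF abs_summable_coeff, of "{A}" z] by (simp add: norm_grassmann_def)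

instance grassmann :: banach
proof
  fix X :: "nat \<Rightarrow> grassmann"
  assume X: "Cauchy X"
  have "Cauchy (\<lambda>n. coeff (X n) A)" for A
  proof (rule metric_CauchyI)
    fix e :: real assume "e > 0"
    then obtain M where M: "\<And>m n. m \<ge> M \<Longrightarrow> n \<ge> M \<Longrightarrow> dist (X m) (X n) < e"
      using metric_CauchyD[OF X] by metis
    have "dist (coeff (X m) A) (coeff (X n) A) < e" if "m \<ge> M" "n \<ge> M" for m n
      using M[OF that] norm_coeff_le[of "X m - X n" A]
      by (simp add: dist_norm minus_grassmann.rep_eq)
    then show "\<exists>M. \<forall>m\<ge>M. \<forall>n\<ge>M. dist (coeff (X m) A) (coeff (X n) A) < e"
      by blast
  qed
  then have "\<forall>A. \<exists>l. (\<lambda>n. coeff (X n) A) \<longlonglongrightarrow> l"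
    by (simp add: Cauchy_convergent_iff convergent_def)
  then obtain f where f: "\<And>A. (\<lambda>n. coeff (X n) A) \<longlonglongrightarrow> f A"
    by metis
  have bound: "\<exists>M. \<forall>n\<ge>M. \<forall>F. finite F \<longrightarrow> (\<Sum>A\<in>F. norm (coeff (X n) A - f A)) \<le> e"
    if e: "e > 0" for e
  proof -
    obtain M where M: "\<And>m n. m \<ge> M \<Longrightarrow> n \<ge> M \<Longrightarrow> norm (X m - X n) < e"
      using metric_CauchyD[OF X e] by (auto simp: dist_norm)
    have "(\<Sum>A\<in>F. norm (coeff (X n) A - f A)) \<le> e" if "n \<ge> M" "finite F" for n F
    proof (rule LIMSEQ_le_const2)
      show "(\<lambda>m. \<Sum>A\<in>F. norm (coeff (X n) A - coeff (X m) A)) \<longlonglongrightarrow>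
          (\<Sum>A\<in>F. norm (coeff (X n) A - f A))"
        by (intro tendsto_intros f)
      have "(\<Sum>A\<in>F. norm (coeff (X n) A - coeff (X m) A)) \<le> e" if "m \<ge> M" for m
        using finite_sum_le_infsum[OF abs_summable_coeff \<open>finite F\<close>, of "X n - X m"]
          M[OF \<open>n \<ge> M\<close> that] by (simp add: norm_grassmann_def minus_grassmann.rep_eq)
      then show "\<exists>N. \<forall>m\<ge>N. (\<Sum>A\<in>F. norm (coeff (X n) A - coeff (X m) A)) \<le> e"
        by blast
    qed
    then show ?thesis
      by blast
  qed
  obtain M where M: "\<And>F. finite F \<Longrightarrow> (\<Sum>A\<in>F. norm (coeff (X M) A - f A)) \<le> 1"
    using bound[of 1] by auto
  have "(\<lambda>A. coeff (X M) A - f A) abs_summable_on UNIV"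
    using M by (intro nonneg_bdd_above_summable_on) (auto simp: bdd_above_def)
  then have "(\<lambda>A. coeff (X M) A + - (coeff (X M) A - f A)) abs_summable_on UNIV"
    by (intro abs_summable_plus abs_summable_coeff) (simp add: norm_minus_commute)
  then have "f abs_summable_on UNIV"
    by simp
  moreover have "f A = 0" if "A \<notin> multi_indices" for A
    using f[of A] that by (simp add: coeff_eq_0 LIMSEQ_const_iff)
  ultimately obtain z where z: "coeff z = f"
    using Abs_grassmann_inverse[of f] by blast
  have "X \<longlonglongrightarrow> z"
  proof (rule metric_LIMSEQ_I)
    fix e :: real assume "e > 0"
    then obtain M where M: "\<And>n F. n \<ge> M \<Longrightarrow> finite F \<Longrightarrow> (\<Sum>A\<in>F. norm (coeff (X n) A - f A)) \<le> e / 2"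
      using bound[of "e / 2"] by auto
    have "dist (X n) z < e" if "n \<ge> M" for n
    proof -
      have "norm (X n - z) \<le> e / 2"
        unfolding norm_grassmann_def using M[OF that] z
        by (intro infsum_le_finite_sums abs_summable_coeff) (auto simp: minus_grassmann.rep_eq)
      then show ?thesis
        using \<open>e > 0\<close> by (simp add: dist_norm)
    qed
    then show "\<exists>M. \<forall>n\<ge>M. dist (X n) z < e"
      by blast
  qed
  then show "convergent X"
    by (auto simp: convergent_def)
qed

abbreviation body :: "grassmann \<Rightarrow> complex" where
  "body z \<equiv> coeff z {}"

lift_definition dag :: "grassmann \<Rightarrow> grassmann"
  is "\<lambda>f A. (-1) ^ (card A * (card A - 1) div 2) * cnj (f A)"
  by (simp add: norm_mult norm_power)

lemma dag_mult: "dag (z * w) = dag w * dag z"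
proof (rule grassmann_eqI)
  fix C
  let ?d = "\<lambda>A :: nat set. (-1) ^ (card A * (card A - 1) div 2) :: complex"
  let ?s = "\<lambda>A B. (-1) ^ inversions A B :: complex"
  show "coeff (dag (z * w)) C = coeff (dag w * dag z) C"
  proof (cases "finite C")
    case True
    have sgn: "?d C * ?s A (C - A) = ?s (C - A) A * ?d A * ?d (C - A)" if "A \<subseteq> C" for A
    proof -
      define m where "m = card A"
      define n where "n = card (C - A)"
      have fin: "finite A" "finite (C - A)"
        using True that by (auto intro: finite_subset)
      have "card C = m + n"
        using True that card_mono[OF True that] fin by (simp add: m_def n_def card_Diff_subset)
      moreover have "(m + n) * (m + n - 1) div 2 = m * (m - 1) div 2 + n * (n - 1) div 2 + m * n"
      proof -
        have "2 * (k * (k - 1) div 2) = k * (k - 1)" for k :: nat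
          by (cases k) auto
        moreover have "(m + n) * (m + n - 1) = m * (m - 1) + n * (n - 1) + 2 * (m * n)"
          by (cases m; cases n) (auto simp: algebra_simps)
        ultimately show ?thesis
          by (metis (no_types, lifting) distrib_left mult_left_cancel zero_neq_numeral)
      qed
      moreover have "m * n = inversions A (C - A) + inversions (C - A) A"
        using inversions_commute[OF fin] by (simp add: m_def n_def)
      moreover have "?s A (C - A) * ?s A (C - A) = 1"
        by (simp flip: power_mult_distrib)
      ultimately show ?thesis
        by (simp only: m_def[symmetric] n_def[symmetric] power_add) (simp add: mult_ac)
    qed
    have "coeff (dag (z * w)) C =
        (\<Sum>A\<in>Pow C. ?d C * ?s A (C - A) * (cnj (coeff z A) * cnj (coeff w (C - A))))"
      by (simp add: dag.rep_eq times_grassmann.rep_eq grass_mult_def sum_distrib_left mult_ac)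
    also have "\<dots> = (\<Sum>B\<in>Pow C. ?d C * ?s (C - B) B * (cnj (coeff z (C - B)) * cnj (coeff w B)))"
      by (rule sum.reindex_bij_witness[of _ "\<lambda>B. C - B" "\<lambda>B. C - B"]) (auto simp: double_diff)
    also have "\<dots> = (\<Sum>B\<in>Pow C. ?s B (C - B) * (?d B * cnj (coeff w B) *
        (?d (C - B) * cnj (coeff z (C - B)))))"
    proof (rule sum.cong)
      fix B assume "B \<in> Pow C"
      then show "?d C * ?s (C - B) B * (cnj (coeff z (C - B)) * cnj (coeff w B)) =
          ?s B (C - B) * (?d B * cnj (coeff w B) * (?d (C - B) * cnj (coeff z (C - B))))"
        using sgn[of "C - B"] by (simp add: double_diff mult_ac)
    qed simp
    also have "\<dots> = coeff (dag w * dag z) C"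
      by (simp add: dag.rep_eq times_grassmann.rep_eq grass_mult_def)
    finally show ?thesis .
  qed (simp add: dag.rep_eq times_grassmann.rep_eq infinite_grass_mult)
qed

text \<open>The generators \<open>i\<^sub>1, i\<^sub>2, \<dots>\<close> and their ordered monomials.\<close>

lift_definition monomial :: "nat set \<Rightarrow> grassmann"
  is "\<lambda>A B. if A \<in> multi_indices \<and> B = A then 1 else 0"
proof
  fix A
  let ?f = "\<lambda>B. if A \<in> multi_indices \<and> B = A then 1 else 0 :: complex"
  have "(\<lambda>B. norm (?f B)) summable_on {A}"
    by simp
  also have "?this \<longleftrightarrow> ?f abs_summable_on UNIV"
    by (rule summable_on_cong_neutral) auto
  finally show "?f abs_summable_on UNIV" .
qed auto

abbreviation generator :: "nat \<Rightarrow> grassmann" where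
  "generator n \<equiv> monomial {n}"

lemma monomial_mult:
  assumes "A \<in> multi_indices" "B \<in> multi_indices"
  shows "monomial A * monomial B =
    (if A \<inter> B = {} then (-1) ^ inversions A B * monomial (A \<union> B) else 0)"
proof (rule grassmann_eqI)
  fix C
  have sign: "coeff ((-1) ^ k * z) C = (-1) ^ k * coeff z C" for k z
    by (cases "even k") (simp_all add: uminus_grassmann.rep_eq)
  have "coeff (monomial A * monomial B) C =
      (\<Sum>A'\<in>Pow C. if A' = A then if C - A = B then (-1) ^ inversions A B else 0 else 0)"
    unfolding times_grassmann.rep_eq grass_mult_def
    by (rule sum.cong) (use assms in \<open>auto simp: monomial.rep_eq\<close>)
  also have "\<dots> = (if finite C \<and> A \<subseteq> C \<and> C - A = B then (-1) ^ inversions A B else 0)"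
    by (cases "finite C") auto
  also have "\<dots> = coeff (if A \<inter> B = {} then (-1) ^ inversions A B * monomial (A \<union> B) else 0) C"
    using assms by (auto simp: sign monomial.rep_eq zero_grassmann.rep_eq multi_indices_def)
  finally show "coeff (monomial A * monomial B) C =
    coeff (if A \<inter> B = {} then (-1) ^ inversions A B * monomial (A \<union> B) else 0) C" .
qed

lemma generator_anticommute:
  assumes "n \<ge> 1" "m \<ge> 1"
  shows "generator n * generator m + generator m * generator n = 0"
proof -
  have *: "inversions {k} {l} = (if l < k then 1 else 0)" for k l :: nat
  proof -
    have "{(a, b). a \<in> {k} \<and> b \<in> {l} \<and> b < a} = (if l < k then {(k, l)} else {})"
      by auto
    then show ?thesis
      by (simp add: inversions_def)
  qed
  show ?thesis
    using assms by (auto simp: monomial_mult multi_indices_def * insert_commute)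
qed

lemma monomial_eq_prod_generators:
  assumes "A \<in> multi_indices"
  shows "monomial A = prod_list (map generator (sorted_list_of_set A))"
proof -
  have "set xs \<subseteq> {1..} \<Longrightarrow> sorted_wrt (<) xs \<Longrightarrow> monomial (set xs) = prod_list (map generator xs)" for xs
  proof (induction xs)
    case Nil
    show ?case
      by (rule grassmann_eqI) (simp add: monomial.rep_eq one_grassmann.rep_eq multi_indices_def)
  next
    case (Cons x xs)
    have "{(a, b). a \<in> {x} \<and> b \<in> set xs \<and> b < a} = {}"
      using Cons.prems by auto
    then have "inversions {x} (set xs) = 0"
      unfolding inversions_def by (simp only: card.empty)
    moreover have "x \<notin> set xs"
      using Cons.prems by auto
    ultimately show ?case
      using Cons monomial_mult[of "{x}" "set xs"] by (simp add: multi_indices_def)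
  qed
  from this[of "sorted_list_of_set A"] show ?thesis
    using assms by (simp add: multi_indices_def)
qed


section \<open>Power series and Blaschke factors\<close>

definition has_inv :: "'a::monoid_mult \<Rightarrow> bool" where
  "has_inv x \<longleftrightarrow> (\<exists>y. x * y = 1 \<and> y * x = 1)"

text \<open>The two-sided inverse, used both for Grassmann numbers and for power series.\<close>

definition inv_of :: "'a::monoid_mult \<Rightarrow> 'a" where
  "inv_of x = (THE y. x * y = 1 \<and> y * x = 1)"

lemma inv_of_eqI:
  assumes "x * y = 1" "y * x = 1"
  shows "inv_of x = y"
  unfolding inv_of_def by (rule the_equality) (use assms in \<open>auto, metis mult.assoc mult_1_left mult_1_right\<close>)

text \<open>
  The star product is the product of formal power series, with \<open>fps_X\<close> in the role of
  the variable \<open>z\<close>, and the constants are embedded by \<open>fps_const\<close>.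
\<close>

lemma star_product_nth: "fps_nth (f * g) n = (\<Sum>u=0..n. fps_nth f u * fps_nth g (n - u))"
  for f g :: "grassmann fps"
  by (rule fps_mult_nth)

lemma inv_of_one_minus_X_const:
  "inv_of (1 - fps_X * fps_const a) = Abs_fps (\<lambda>n. a ^ n)" for a :: grassmann
proof (rule inv_of_eqI)
  let ?F = "Abs_fps (\<lambda>n. a ^ n)"
  show "(1 - fps_X * fps_const a) * ?F = 1"
    by (rule fps_ext) (simp add: left_diff_distrib mult.assoc flip: power_Suc)
  have "?F * (fps_X * fps_const a) = fps_X * (?F * fps_const a)"
    by (metis fps_mult_fps_X_commute mult.assoc)
  then show "?F * (1 - fps_X * fps_const a) = 1"
    by (intro fps_ext) (simp add: right_diff_distrib flip: power_Suc2)
qed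

text \<open>The value at \<open>z\<close> puts the coefficients to the right of the powers of \<open>z\<close>.\<close>

definition has_value :: "grassmann fps \<Rightarrow> grassmann \<Rightarrow> grassmann \<Rightarrow> bool" where
  "has_value f z v \<longleftrightarrow> (\<lambda>n. z ^ n * fps_nth f n) sums v"

definition blaschke :: "grassmann \<Rightarrow> grassmann \<Rightarrow> grassmann \<Rightarrow> grassmann fps" where
  "blaschke a c p =
     1 - (1 - fps_X) * fps_const c * inv_of (1 - fps_X * fps_const a)
           * fps_const (inv_of p) * fps_const (dag (inv_of (1 - a))) * fps_const (dag c)"

end

theory Submission
  imports Defs
begin

text \<open>
  With \<open>P = c\<^sup>-\<^sup>\<dagger> p c\<^sup>-\<^sup>1\<close> and \<open>q = c p\<^sup>-\<^sup>1 (1 - a)\<^sup>-\<^sup>\<dagger> c\<^sup>\<dagger>\<close>, the hypothesis reads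
  \<open>P - \<omega> P \<omega>\<^sup>\<dagger> = 1\<close>, while \<open>(1 - \<omega>) P q = 1\<close> and \<open>c (1 - z a)\<^sup>-\<^sup>\<star> = (1 - z \<omega>\<^sup>\<dagger>)\<^sup>-\<^sup>\<star> c\<close>. Pulling
  \<open>(1 - z \<omega>\<^sup>\<dagger>)\<^sup>-\<^sup>\<star> q\<close> out of \<open>b\<^sub>a\<close> on the right leaves
  \<open>(1 - \<omega>) P (1 - z \<omega>\<^sup>\<dagger>) - (1 - z)\<close>, a polynomial identity away from the claimed factorization.
  The value of \<open>(z - \<omega>) \<star> g\<close> at \<open>\<omega>\<close> telescopes to the limit of \<open>- \<omega>\<^sup>n\<^sup>+\<^sup>1 g\<^sub>n\<close>, which is \<open>0\<close> because
  the powers of a Grassmann number with body in the open unit disc decay geometrically.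
  For the decay, multiply the generators \<open>i\<^sub>k\<close>, \<open>k \<in> S\<close>, by a small \<open>\<delta> > 0\<close>, where
  \<open>S\<close> is a large finite set. This is an injective algebra endomorphism with bounded left inverse,
  and it makes the norm of the number less than \<open>1\<close>.
\<close>

section \<open>Powers of Grassmann numbers\<close>

lemma norm_le_if_coeff_le:
  assumes "\<And>A. norm (coeff x A) \<le> K * norm (coeff y A)"
  shows "norm x \<le> K * norm y"
  unfolding norm_grassmann_def
  by (subst infsum_cmult_right'[symmetric], rule infsum_mono)
    (use assms abs_summable_coeff in \<open>auto intro: summable_on_cmult_right\<close>)

section \<open>Rules for the body and the dagger\<close>

lemma body_mult: "body (x * y) = body x * body y"
  by (simp add: times_grassmann.rep_eq grass_mult_def)

lemma body_one: "body 1 = 1"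
  by (simp add: one_grassmann.rep_eq)

lemma body_dag: "body (dag x) = cnj (body x)"
  by (simp add: dag.rep_eq)

lemma dag_one: "dag 1 = 1"
  by (rule grassmann_eqI) (simp add: dag.rep_eq one_grassmann.rep_eq)

lemma dag_minus: "dag (x - y) = dag x - dag y"
  by (rule grassmann_eqI) (simp add: dag.rep_eq minus_grassmann.rep_eq algebra_simps)

lemma dag_dag: "dag (dag x) = x"
  by (rule grassmann_eqI) (simp add: dag.rep_eq flip: mult.assoc power_mult_distrib)

section \<open>Dilation of the generators\<close>

text \<open>The small scaling factor is \<open>inverse (Suc n)\<close>: always in (0, 1], so
  absolute summability survives.\<close>

lift_definition dilate :: "nat \<Rightarrow> nat set \<Rightarrow> grassmann \<Rightarrow> grassmann"
  is "\<lambda>n S f A. inverse (of_nat (Suc n)) ^ card (A \<inter> S) * f A"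
proof (intro conjI allI impI; elim conjE)
  fix n S and f :: "nat set \<Rightarrow> complex"
  assume "f abs_summable_on UNIV"
  then show "(\<lambda>A. inverse (of_nat (Suc n)) ^ card (A \<inter> S) * f A) abs_summable_on UNIV"
  proof (rule abs_summable_on_comparison_test')
    fix A
    have "inverse (real (Suc n)) ^ card (A \<inter> S) \<le> 1"
      by (intro power_le_one) (auto simp: field_simps)
    then show "norm (inverse (of_nat (Suc n)) ^ card (A \<inter> S) * f A) \<le> norm (f A)"
      using mult_right_mono[of _ 1 "norm (f A)"]
      by (simp add: norm_mult norm_power norm_inverse del: of_nat_Suc)
  qed
qed simp

lemma norm_coeff_dilate:
  "norm (coeff (dilate n S x) A) = inverse (real (Suc n)) ^ card (A \<inter> S) * norm (coeff x A)"
  by (simp add: dilate.rep_eq norm_mult norm_power norm_inverse del: of_nat_Suc)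

lemma dilate_one: "dilate n S 1 = 1"
  by (rule grassmann_eqI) (simp add: dilate.rep_eq one_grassmann.rep_eq)

text \<open>Only complementary pairs \<open>A\<close>, \<open>C - A\<close> enter a product, so the
  exponents add up to \<open>card (C \<inter> S)\<close>.\<close>

lemma dilate_mult: "dilate n S (x * y) = dilate n S x * dilate n S y"
proof (rule grassmann_eqI)
  fix C
  show "coeff (dilate n S (x * y)) C = coeff (dilate n S x * dilate n S y) C"
  proof (cases "finite C")
    case True
    have "card (C \<inter> S) = card (A \<inter> S) + card ((C - A) \<inter> S)" if "A \<subseteq> C" for A
    proof -
      have "C \<inter> S = (A \<inter> S) \<union> ((C - A) \<inter> S)"
        using that by blast
      moreover have "finite A"
        using that True by (rule finite_subset)
      ultimately show ?thesis
        using True card_Un_disjoint[of "A \<inter> S" "(C - A) \<inter> S"] by auto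
    qed
    then show ?thesis
      by (auto simp: dilate.rep_eq times_grassmann.rep_eq grass_mult_def sum_distrib_left power_add
          simp del: of_nat_Suc intro!: sum.cong)
  qed (simp add: dilate.rep_eq times_grassmann.rep_eq infinite_grass_mult)
qed

lemma dilate_power: "dilate n S (x ^ m) = dilate n S x ^ m"
  by (induction m) (simp_all add: dilate_one dilate_mult)

text \<open>A coefficient shrinks at most \<open>card S\<close> times, so finiteness of
  \<open>S\<close> gives a bound uniform in \<open>x\<close>.\<close>

lemma norm_le_dilate:
  assumes "finite S"
  shows "norm x \<le> real (Suc n) ^ card S * norm (dilate n S x)"
proof (rule norm_le_if_coeff_le)
  fix A
  have "real (Suc n) ^ card (A \<inter> S) \<le> real (Suc n) ^ card S"
    using assms by (intro power_increasing card_mono) auto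
  then have "1 \<le> real (Suc n) ^ card S * inverse (real (Suc n)) ^ card (A \<inter> S)"
    by (simp add: power_inverse field_simps del: of_nat_Suc)
  from mult_right_mono[OF this, of "norm (coeff x A)"]
  show "norm (coeff x A) \<le> real (Suc n) ^ card S * norm (coeff (dilate n S x) A)"
    by (simp add: norm_coeff_dilate mult.assoc del: of_nat_Suc)
qed

lemma ex_norm_dilate_less:
  assumes "cmod (body x) < r"
  shows "\<exists>n S. finite S \<and> norm (dilate n S x) < r"
proof -
  \<comment> \<open>The damped part and the tail cost \<open>e\<close> each; the third
    \<open>e\<close> makes the inequality strict.\<close>
  define e where "e = (r - cmod (body x)) / 3"
  have e: "e > 0"
    using assms by (simp add: e_def)
  obtain F where F: "finite F" "dist (\<Sum>A\<in>F. norm (coeff x A)) (norm x) \<le> e"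
    using infsum_finite_approximation[OF abs_summable_coeff e, of x] unfolding norm_grassmann_def by blast
  \<comment> \<open>Restricting to \<open>multi_indices\<close> keeps \<open>S\<close> finite; the
    other members of \<open>F\<close> carry coefficient 0.\<close>
  define S where "S = \<Union>(F \<inter> multi_indices)"
  have S: "finite S"
    using F(1) by (auto simp: S_def multi_indices_def)
  obtain n where n: "inverse (real (Suc n)) < e / (norm x + 1)"
    using reals_Archimedean[of "e / (norm x + 1)"] e
    by (auto simp: add_nonneg_pos)
  let ?d = "inverse (real (Suc n))"
  have d: "0 < ?d" "?d \<le> 1"
    by (auto simp: field_simps)
  have small: "?d * norm x \<le> e"
  proof -
    have "?d * (norm x + 1) < e"
      using n by (simp add: pos_less_divide_eq add_nonneg_pos del: of_nat_Suc)
    then show ?thesis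
      using d(1) unfolding distrib_left by linarith
  qed
  have sum_le: "(\<Sum>A\<in>G. norm (coeff x A)) \<le> norm x" if "finite G" for G
    using finite_sum_le_infsum[OF abs_summable_coeff that, of x] by (simp add: norm_grassmann_def)
  have "norm (dilate n S x) \<le> cmod (body x) + e + e"
    unfolding norm_grassmann_def
  proof (rule infsum_le_finite_sums[OF abs_summable_coeff])
    fix G :: "nat set set"
    assume G: "finite G"
    \<comment> \<open>The three terms are the body, the indices meeting \<open>S\<close> (damped at
      least once) and the tail outside \<open>F\<close>.\<close>
    have le: "norm (coeff (dilate n S x) A) \<le> (if A = {} then cmod (body x) else 0)
        + ?d * norm (coeff x A) + (if A \<in> F then 0 else norm (coeff x A))" for A
    proof (cases "A \<in> F \<and> A \<noteq> {} \<and> A \<in> multi_indices")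
      case True
      then have "A \<inter> S \<noteq> {}"
        by (auto simp: S_def)
      then have "card (A \<inter> S) \<ge> 1"
        using S by (simp add: Suc_le_eq card_gt_0_iff)
      then have "?d ^ card (A \<inter> S) \<le> ?d"
        using power_decreasing[of 1 "card (A \<inter> S)" ?d] d by simp
      from mult_right_mono[OF this, of "norm (coeff x A)"] show ?thesis
        using True by (simp add: norm_coeff_dilate del: of_nat_Suc)
    next
      case False
      have "?d ^ card (A \<inter> S) * norm (coeff x A) \<le> 1 * norm (coeff x A)"
        using d by (intro mult_right_mono power_le_one) auto
      moreover have "0 \<le> ?d * norm (coeff x A)"
        using d by simp
      ultimately have "norm (coeff (dilate n S x) A) \<le> norm (coeff x A) + ?d * norm (coeff x A)"
        unfolding norm_coeff_dilate by linarith
      then show ?thesis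
        using False coeff_eq_0[of A x] norm_ge_zero[of "coeff x A"]
        by (auto simp del: of_nat_Suc norm_ge_zero)
    qed
    have tail: "(\<Sum>A\<in>G - F. norm (coeff x A)) \<le> e"
    proof -
      have "(\<Sum>A\<in>G \<union> F. norm (coeff x A)) =
          (\<Sum>A\<in>G - F. norm (coeff x A)) + (\<Sum>A\<in>F. norm (coeff x A))"
        using G F(1) by (subst sum.union_disjoint[symmetric]) (auto intro!: sum.cong)
      then show ?thesis
        using sum_le[of "G \<union> F"] G F by (simp add: dist_real_def)
    qed
    have "(\<Sum>A\<in>G. norm (coeff (dilate n S x) A)) \<le> (\<Sum>A\<in>G. if A = {} then cmod (body x) else 0)
        + ?d * (\<Sum>A\<in>G. norm (coeff x A)) + (\<Sum>A\<in>G. if A \<in> F then 0 else norm (coeff x A))"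
      unfolding sum_distrib_left sum.distrib[symmetric] by (rule sum_mono[OF le])
    also have "(\<Sum>A\<in>G. if A = {} then cmod (body x) else 0) \<le> cmod (body x)"
      using G by simp
    also have "?d * (\<Sum>A\<in>G. norm (coeff x A)) \<le> e"
      using mult_left_mono[OF sum_le[OF G], of ?d] d small by linarith
    also have "(\<Sum>A\<in>G. if A \<in> F then 0 else norm (coeff x A)) = (\<Sum>A\<in>G - F. norm (coeff x A))"
      using G by (intro sum.mono_neutral_cong_right) auto
    also have "\<dots> \<le> e"
      by (rule tail)
    finally show "(\<Sum>A\<in>G. norm (coeff (dilate n S x) A)) \<le> cmod (body x) + e + e"
      by simp
  qed
  also have "\<dots> < r"
    using assms by (simp add: e_def field_simps)
  finally show ?thesis
    using S by blast
qed

section \<open>Geometric decay and the Neumann series\<close>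

lemma summable_power_if_body_less_1:
  fixes x :: grassmann
  assumes "cmod (body x) < 1"
  shows "summable (\<lambda>m. x ^ m)"
proof -
  obtain n S where S: "finite S" and less: "norm (dilate n S x) < 1"
    using ex_norm_dilate_less[OF assms] by blast
  have "norm (x ^ m) \<le> real (Suc n) ^ card S * norm (dilate n S x) ^ m" for m
    using norm_le_dilate[OF S, of "x ^ m" n] norm_power_ineq[of "dilate n S x" m]
    by (metis dilate_power mult_left_mono of_nat_0_le_iff order_trans zero_le_power)
  moreover have "summable (\<lambda>m. real (Suc n) ^ card S * norm (dilate n S x) ^ m)"
    using less by (intro summable_mult summable_geometric) simp
  ultimately show ?thesis
    by (rule summable_comparison_test'[rotated])
qed

text \<open>The hypothesis is summability instead of \<open>norm x < 1\<close> because a body in the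
  unit disc does not bound the norm by 1.\<close>

lemma has_inv_one_minus:
  fixes x :: "'a::{real_normed_algebra_1, banach}"
  assumes "summable (\<lambda>m. x ^ m)"
  shows "has_inv (1 - x)"
proof -
  let ?s = "\<Sum>m. x ^ m"
  have "?s = 1 + (\<Sum>m. x ^ Suc m)"
    using suminf_split_head[OF assms] by simp
  moreover have "(\<Sum>m. x ^ Suc m) = x * ?s"
    using suminf_mult[OF assms] by simp
  moreover have "(\<Sum>m. x ^ Suc m) = ?s * x"
    unfolding power_Suc2 using suminf_mult2[OF assms] by simp
  ultimately have "?s = 1 + x * ?s" "?s = 1 + ?s * x"
    by simp_all
  then show ?thesis
    unfolding has_inv_def by (intro exI[of _ ?s]) (simp add: algebra_simps)
qed

lemma inv_of_works:
  assumes "has_inv x"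
  shows "x * inv_of x = 1" "inv_of x * x = 1"
  using assms inv_of_eqI[of x] unfolding has_inv_def by metis+


section \<open>The factorization\<close>

lemma has_value_factor_zero:
  assumes "(\<lambda>n. w ^ Suc n * fps_nth g n) \<longlonglongrightarrow> 0"
  shows "has_value ((fps_X - fps_const w) * g) w 0"
proof -
  let ?h = "(fps_X - fps_const w) * g"
  \<comment> \<open>For positive \<open>n\<close> the summand is
    \<open>w ^ n * g_(n-1) - w ^ (n+1) * g_n\<close>, where \<open>g_n\<close> is the coefficient of
    \<open>g\<close>; the sum telescopes.\<close>
  have "(\<Sum>n<Suc N. w ^ n * fps_nth ?h n) = - (w ^ Suc N * fps_nth g N)" for N
  proof (induction N)
    case (Suc N)
    then show ?case
      by (simp add: left_diff_distrib right_diff_distrib power_Suc2 mult.assoc del: power_Suc)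
  qed (simp add: left_diff_distrib)
  then have "(\<lambda>N. \<Sum>n<Suc N. w ^ n * fps_nth ?h n) \<longlonglongrightarrow> 0"
    using tendsto_minus[OF assms] by simp
  then show ?thesis
    unfolding has_value_def sums_def
    by (rule filterlim_sequentially_Suc[of "\<lambda>N. \<Sum>n<N. w ^ n * fps_nth ?h n", THEN iffD1])
qed

text \<open>The intertwining relation passes to all powers, hence to every coefficient of the
  resolvents.\<close>

lemma const_mult_resolvent:
  fixes a c v :: grassmann
  assumes "v * c = c * a"
  shows "fps_const c * inv_of (1 - fps_X * fps_const a) =
    inv_of (1 - fps_X * fps_const v) * fps_const c"
proof -
  have "v ^ n * c = c * a ^ n" for n
  proof (induction n)
    case (Suc n)
    have "v ^ Suc n * c = v * (v ^ n * c)"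
      by (simp add: mult.assoc)
    also have "\<dots> = (v * c) * a ^ n"
      by (simp only: Suc mult.assoc)
    finally show ?case
      by (simp add: assms mult.assoc)
  qed simp
  then show ?thesis
    by (intro fps_ext) (simp add: inv_of_one_minus_X_const)
qed

lemma one_minus_resolvent_factor:
  fixes w v P q :: grassmann
  assumes P: "P - w * P * v = 1" and q: "(1 - w) * P * q = 1"
  shows "1 - (1 - fps_X) * inv_of (1 - fps_X * fps_const v) * fps_const q =
    (fps_X - fps_const w) * fps_const (1 + (w - 1) * P * v)
      * inv_of (1 - fps_X * fps_const v) * fps_const q"
proof -
  let ?D = "1 - fps_X * fps_const v" and ?R = "inv_of (1 - fps_X * fps_const v)"
  let ?M = "fps_const ((1 - w) * P)"
  have DR: "?D * ?R = 1"
    unfolding inv_of_one_minus_X_const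
    by (rule fps_ext) (simp add: left_diff_distrib mult.assoc flip: power_Suc)
  have wPv: "w * (P * v) = P - 1"
    using P by (simp add: algebra_simps)
  have "w * (w * (P * v)) = w * P - w"
    by (simp add: wPv right_diff_distrib)
  \<comment> \<open>This is the comparison of constant coefficients in \<open>bracket\<close>, and
    the place where the hypothesis on \<open>P\<close> enters.\<close>
  then have const: "(1 - w) * P - 1 = - w * (1 + (w - 1) * P * v)"
    using wPv by (simp add: algebra_simps)
  have lin: "1 - (1 - w) * P * v = 1 + (w - 1) * P * v"
    by (simp add: algebra_simps)
  \<comment> \<open>Both sides have degree at most 1 in \<open>fps_X\<close>: \<open>const\<close>
    settles coefficient 0, \<open>lin\<close> coefficient 1.\<close>
  have bracket: "?M * ?D - (1 - fps_X) = (fps_X - fps_const w) * fps_const (1 + (w - 1) * P * v)"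
  proof (rule fps_ext)
    fix n
    show "fps_nth (?M * ?D - (1 - fps_X)) n =
        fps_nth ((fps_X - fps_const w) * fps_const (1 + (w - 1) * P * v)) n"
      using const lin by (cases "n = 0"; cases "n = 1")
        (simp_all add: right_diff_distrib left_diff_distrib fps_mult_fps_X_commute flip: mult.assoc)
  qed
  have "1 = ?M * fps_const q"
    using q by simp
  also have "\<dots> = ?M * ?D * ?R * fps_const q"
    by (metis DR mult.assoc mult_1_right)
  finally have "1 - (1 - fps_X) * ?R * fps_const q = (?M * ?D - (1 - fps_X)) * ?R * fps_const q"
    by (simp only: left_diff_distrib)
  then show ?thesis
    unfolding bracket .
qed

theorem proposition11p1:
  fixes a c p \<omega> :: grassmann
  defines "\<omega> \<equiv> dag (inv_of c) * dag a * dag c"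
  assumes "has_inv c" and "has_inv p" and "p = dag p" and "cmod (body a) < 1"
    and "p - dag a * p * a = dag c * c"
  shows "has_value (blaschke a c p) \<omega> 0 \<and>
    blaschke a c p =
      (fps_X - fps_const \<omega>)
        * fps_const (1 + (\<omega> - 1) * dag (inv_of c) * p * inv_of c * dag \<omega>)
        * inv_of (1 - fps_X * fps_const (dag \<omega>))
        * fps_const c * fps_const (inv_of p) * fps_const (dag (inv_of (1 - a))) * fps_const (dag c)"
proof -
  define ci pi ai where "ci = inv_of c" and "pi = inv_of p" and "ai = inv_of (1 - a)"
  have c: "c * ci = 1" "ci * c = 1" and p: "p * pi = 1"
    using inv_of_works[OF assms(2)] inv_of_works[OF assms(3)] by (simp_all add: ci_def pi_def)
  have ai: "ai * (1 - a) = 1"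
    using inv_of_works[OF has_inv_one_minus[OF summable_power_if_body_less_1[OF assms(5)]]]
    by (simp add: ai_def)
  have dc: "dag c * dag ci = 1" "dag ci * dag c = 1" and dai: "(1 - dag a) * dag ai = 1"
    using c ai by (metis dag_minus dag_mult dag_one)+
  have w: "\<omega> = dag ci * dag a * dag c"
    by (simp add: \<omega>_def ci_def)
  have v: "dag \<omega> = c * a * ci"
    by (simp add: w dag_mult dag_dag mult.assoc)
  define P where "P = dag ci * p * ci"
  define q where "q = c * pi * dag ai * dag c"
  have "\<omega> * P * dag \<omega> = dag ci * (dag a * ((dag c * dag ci) * (p * ((ci * c) * (a * ci)))))"
    unfolding v unfolding P_def w by (simp only: mult.assoc)
  also have "\<dots> = dag ci * (dag a * p * a) * ci"
    using c dc by (simp add: mult.assoc)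
  finally have "P - \<omega> * P * dag \<omega> = dag ci * (p - dag a * p * a) * ci"
    by (simp add: P_def algebra_simps)
  also have "\<dots> = (dag ci * dag c) * (c * ci)"
    unfolding assms(6) by (simp only: mult.assoc)
  finally have P: "P - \<omega> * P * dag \<omega> = 1"
    using c dc by simp
  have "\<omega> * dag ci = dag ci * dag a"
    using dc by (simp add: w mult.assoc)
  \<comment> \<open>Moving \<open>1 - \<omega>\<close> past \<open>dag ci\<close> produces the
    factor \<open>1 - dag a\<close> that cancels \<open>dag ai\<close> in \<open>q\<close>.\<close>
  then have shift: "(1 - \<omega>) * dag ci = dag ci * (1 - dag a)"
    by (simp add: algebra_simps)
  have "(1 - \<omega>) * P * q = (1 - \<omega>) * dag ci * (p * ((ci * c) * (pi * (dag ai * dag c))))"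
    by (simp only: P_def q_def mult.assoc)
  also have "\<dots> = dag ci * ((1 - dag a) * ((p * pi) * (dag ai * dag c)))"
    unfolding shift using c by (simp add: mult.assoc)
  also have "\<dots> = dag ci * (((1 - dag a) * dag ai) * dag c)"
    using p by (simp add: mult.assoc)
  finally have q: "(1 - \<omega>) * P * q = 1"
    using dai dc by simp
  let ?R = "inv_of (1 - fps_X * fps_const (dag \<omega>))"
  let ?k = "1 + (\<omega> - 1) * P * dag \<omega>"
  have "dag \<omega> * c = c * a"
    using c by (simp add: v mult.assoc)
  note res = const_mult_resolvent[OF this]
  have "blaschke a c p = 1 - (1 - fps_X) * (fps_const c * inv_of (1 - fps_X * fps_const a))
      * fps_const (pi * dag ai * dag c)"
    by (simp add: blaschke_def ai_def pi_def mult.assoc flip: fps_const_mult)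
  also have "\<dots> = 1 - (1 - fps_X) * ?R * fps_const q"
    unfolding res q_def by (simp add: mult.assoc flip: fps_const_mult)
  also have "\<dots> = (fps_X - fps_const \<omega>) * fps_const ?k * ?R * fps_const q"
    by (rule one_minus_resolvent_factor[OF P q])
  finally have fac: "blaschke a c p = (fps_X - fps_const \<omega>) * fps_const ?k * ?R * fps_const q" .
  \<comment> \<open>Bodies commute, so the conjugation defining \<open>\<omega>\<close> leaves the
    body of \<open>dag a\<close> unchanged.\<close>
  have "body (dag ci) * body (dag c) = 1"
    using dc(2) by (metis body_mult body_one)
  then have "body \<omega> = body (dag a)"
    by (simp add: w body_mult)
  then have body: "cmod (body \<omega>) < 1" "cmod (body (dag \<omega>)) < 1"
    using assms(5) by (simp_all add: body_dag)
  note lim = body[THEN summable_power_if_body_less_1, THEN summable_LIMSEQ_zero]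
  \<comment> \<open>The cofactor of \<open>fps_X - fps_const \<omega>\<close> has coefficients
    \<open>?k * dag \<omega> ^ n * q\<close>.\<close>
  have "(\<lambda>n. \<omega> ^ Suc n * (?k * dag \<omega> ^ n * q)) \<longlonglongrightarrow> 0 * (?k * 0 * q)"
    by (rule tendsto_mult[OF LIMSEQ_Suc[OF lim(1)]
          tendsto_mult[OF tendsto_mult[OF tendsto_const lim(2)] tendsto_const]])
  then have "has_value ((fps_X - fps_const \<omega>) * (fps_const ?k * ?R * fps_const q)) \<omega> 0"
    by (intro has_value_factor_zero) (simp add: inv_of_one_minus_X_const mult.assoc del: power_Suc)
  then have "has_value (blaschke a c p) \<omega> 0"
    unfolding fac by (simp only: mult.assoc)
  moreover have "blaschke a c p = (fps_X - fps_const \<omega>) * fps_const ?k * ?R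
      * fps_const c * fps_const pi * fps_const (dag ai) * fps_const (dag c)"
    unfolding fac q_def by (simp add: mult.assoc flip: fps_const_mult)
  ultimately show ?thesis
    by (simp add: P_def ci_def pi_def ai_def mult.assoc)
qed

end
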